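(* $$\sum_{n=1}^{\infty}\frac{\log n\,\cos(n\pi/2)}{(\pi n)^2}=\frac{1}{48}\left[\log(2\pi)+\gamma-1\right]+\frac14\zeta'(-1).$$
   Context: $\gamma$ is Euler's constant and $\zeta'(-1)$ is the derivative at $-1$ of the (analytically continued) Riemann zeta function $\zeta$. *)

theory Defs
  imports "HOL-Complex_Analysis.Complex_Analysis"
begin

text \<open>The distribution has no Riemann zeta function.  It is introduced here as the analytic
  continuation of its Dirichlet series.  The two lemmas at the end show that such a
  continuation exists and is unique; only the value at the pole \<open>1\<close> is left unspecified.\<close>

definition is_zeta_continuation :: "(complex \<Rightarrow> complex) \<Rightarrow> bool" where
  "is_zeta_continuation f \<longleftrightarrow>
     f holomorphic_on (- {1}) \<and>
     (\<forall>s. Re s > 1 \<longrightarrow> (\<lambda>n. of_nat (Suc n) powr (- s)) sums f s)"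

definition zeta :: "complex \<Rightarrow> complex" where
  "zeta = (SOME f. is_zeta_continuation f)"

text \<open>Existence.  For \<open>Re s > 1\<close> let \<open>A k s\<close> be the sum over \<open>n \<ge> 1\<close> of the integrals of
  \<open>x ^ k * (n + x) powr (- s)\<close> over \<open>[0, 1]\<close>.  Integration by parts expresses \<open>A k s\<close> through
  \<open>\<zeta> s\<close> and \<open>A (k + 1) (s + 1)\<close>, and \<open>A 0 s = 1 / (s - 1)\<close>.  The resulting recursion for
  \<open>(s - 1) * A k s\<close> shifts the half-plane of holomorphy to the left by one in each step.\<close>

definition zexp :: "nat \<Rightarrow> complex \<Rightarrow> real \<Rightarrow> complex" where
  "zexp i s x = exp (- s * of_real (ln (real i + 1 + x)))"

definition zint :: "nat \<Rightarrow> nat \<Rightarrow> complex \<Rightarrow> complex" where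
  "zint i k s = integral (cbox 0 1) (\<lambda>x::real. of_real (x ^ k) * zexp i s x)"

fun zB :: "nat \<Rightarrow> nat \<Rightarrow> complex \<Rightarrow> complex" where
  "zB 0 k s = (s - 1) * (\<Sum>i. zint i k s)"
| "zB (Suc m) k s =
     (1 + (s - 1) * (zB m (Suc k) (s + 1) - zB m 1 (s + 1))) / of_nat (Suc k)"

lemma continuous_on_ln_shift:
  "continuous_on (A \<times> cbox 0 1) (\<lambda>z. ln (real i + 1 + snd z))"
  "continuous_on {0..1} (\<lambda>x. ln (real i + 1 + x))"
  by (force intro!: continuous_intros)+

lemma zint_integrable: "(\<lambda>x::real. of_real (x ^ k) * zexp i s x) integrable_on cbox 0 1"
  unfolding zexp_def
  by (rule integrable_continuous) (use continuous_on_ln_shift in \<open>auto intro!: continuous_intros\<close>)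

lemma zint_has_integral:
  "((\<lambda>x::real. of_real (x ^ k) * zexp i s x) has_integral zint i k s) {0..1}"
  using integrable_integral[OF zint_integrable[of k i s]] by (simp add: zint_def)

lemma zint_holomorphic: "zint i k holomorphic_on UNIV"
proof -
  have "(\<lambda>s. integral (cbox 0 1) (\<lambda>x::real. of_real (x ^ k) * zexp i s x)) holomorphic_on UNIV"
    unfolding zexp_def
  proof (rule leibniz_rule_holomorphic)
    fix s :: complex and t :: real
    show "((\<lambda>s. of_real (t ^ k) * exp (- s * of_real (ln (real i + 1 + t)))) has_field_derivative
       of_real (t ^ k) * (- of_real (ln (real i + 1 + t)) * exp (- s * of_real (ln (real i + 1 + t)))))
       (at s within UNIV)"
      by (auto intro!: derivative_eq_intros)
  next
    show "continuous_on (UNIV \<times> cbox 0 1) (\<lambda>(s, t). of_real (t ^ k) *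
      (- of_real (ln (real i + 1 + t)) * exp (- s * of_real (ln (real i + 1 + t)))) :: complex)"
      unfolding case_prod_unfold by (intro continuous_intros continuous_on_ln_shift)
  qed (use zint_integrable in \<open>auto simp: zexp_def\<close>)
  then show ?thesis by (simp add: zint_def [abs_def])
qed

lemma zint_bound:
  assumes "a \<le> Re s" "0 \<le> a"
  shows "norm (zint i k s) \<le> real (Suc i) powr (- a)"
proof -
  have "norm (zint i k s) \<le> integral (cbox 0 1) (\<lambda>x::real. real (Suc i) powr (- a))"
    unfolding zint_def
  proof (rule integral_norm_bound_integral[OF zint_integrable])
    fix x :: real assume x: "x \<in> cbox 0 1"
    have l: "0 \<le> ln (real i + 1)" "ln (real i + 1) \<le> ln (real i + 1 + x)" using x by auto
    have "a * ln (real i + 1) \<le> Re s * ln (real i + 1 + x)"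
      using l assms by (intro mult_mono) auto
    then have "exp (- (Re s * ln (real i + 1 + x))) \<le> real (Suc i) powr (- a)"
      by (simp add: powr_def add.commute)
    moreover have "\<bar>x ^ k\<bar> \<le> 1" using x by (simp add: power_le_one)
    ultimately show "norm (of_real (x ^ k) * zexp i s x) \<le> real (Suc i) powr (- a)"
      using mult_mono[of "\<bar>x ^ k\<bar>" 1 "exp (- (Re s * ln (real i + 1 + x)))" "real (Suc i) powr (- a)"]
      by (simp add: zexp_def norm_mult norm_power power_abs)
  qed auto
  then show ?thesis by simp
qed

lemma summable_Suc_powr: "1 < a \<Longrightarrow> summable (\<lambda>i. real (Suc i) powr (- a))"
  using summable_real_powr_iff[of "- a"] summable_Suc_iff[of "\<lambda>n. real n powr - a"] by simp

lemma zint_summable: "1 < Re s \<Longrightarrow> summable (\<lambda>i. zint i k s)"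
  by (rule summable_comparison_test'[OF summable_Suc_powr[of "Re s"], of 0])
     (auto intro: zint_bound simp del: of_nat_Suc)

lemma zint_sum_holomorphic: "(\<lambda>s. \<Sum>i. zint i k s) holomorphic_on {s. 1 < Re s}"
proof (rule holomorphic_uniform_sequence)
  show "open {s. 1 < Re s}" by (rule open_halfspace_Re_gt)
  show "(\<lambda>s. \<Sum>i<n. zint i k s) holomorphic_on {s. 1 < Re s}" for n
    using zint_holomorphic by (intro holomorphic_intros) (auto intro: holomorphic_on_subset)
  fix s assume s: "s \<in> {s. 1 < Re s}"
  define d where "d = (Re s - 1) / 2"
  have R: "1 + d \<le> Re z" if "z \<in> cball s d" for z
    using that abs_Re_le_cmod[of "s - z"] by (simp add: dist_norm d_def field_simps)
  have d: "0 < d" using s by (simp add: d_def)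
  moreover have "cball s d \<subseteq> {s. 1 < Re s}" using R d by force
  moreover have "uniform_limit (cball s d) (\<lambda>n s. \<Sum>i<n. zint i k s) (\<lambda>s. \<Sum>i. zint i k s) sequentially"
    by (rule Weierstrass_m_test_ev[OF _ summable_Suc_powr[of "1 + d"]])
       (use d R in \<open>auto intro!: always_eventually zint_bound simp del: of_nat_Suc minus_add_distrib\<close>)
  ultimately show "\<exists>d>0. cball s d \<subseteq> {s. 1 < Re s} \<and>
      uniform_limit (cball s d) (\<lambda>n s. \<Sum>i<n. zint i k s) (\<lambda>s. \<Sum>i. zint i k s) sequentially"
    by blast
qed

lemma zexp_shift:
  assumes "0 \<le> x"
  shows "zexp i (s + 1) x = zexp i s x / of_real (real i + 1 + x)"
proof -
  have "exp (complex_of_real (ln (real i + 1 + x))) = of_real (real i + 1 + x)"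
    using assms by (metis add_pos_nonneg exp_ln exp_of_real of_nat_0_le_iff
        zero_less_one add.commute)
  then show ?thesis by (simp add: zexp_def ring_distribs exp_diff)
qed

lemma zexp_deriv:
  assumes "x \<in> {0..1}"
  shows "(zexp i s has_vector_derivative - s * zexp i (s + 1) x) (at x within {0..1})"
proof -
  have p: "real i + 1 + x > 0" using assms by simp
  have 2: "((\<lambda>x. complex_of_real (ln (real i + 1 + x))) has_vector_derivative
       of_real (1 / (real i + 1 + x))) (at x within {0..1})"
    using p
    by (intro has_vector_derivative_of_real)
       (auto simp flip: has_real_derivative_iff_has_vector_derivative intro!: derivative_eq_intros)
  have "((\<lambda>x. zexp i s x) has_vector_derivative
       of_real (1 / (real i + 1 + x)) * (- s * zexp i s x)) (at x within {0..1})"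
    unfolding zexp_def
    by (rule field_vector_diff_chain_within[OF 2, of "\<lambda>z. exp (- s * z)", unfolded o_def])
       (auto intro!: derivative_eq_intros)
  then show ?thesis
    by (rule has_vector_derivative_eq_rhs) (use assms in \<open>simp add: zexp_shift\<close>)
qed

lemma zexp_endpoints:
  "zexp i s 0 = of_nat (Suc i) powr (- s)"
  "zexp i s 1 = of_nat (Suc (Suc i)) powr (- s)"
proof -
  have "complex_of_real (ln (real n)) = Ln (of_nat n)" if "n > 0" for n
    using Ln_of_real[of "real n"] that by simp
  from this[of "Suc i"] this[of "Suc (Suc i)"] show
    "zexp i s 0 = of_nat (Suc i) powr (- s)"
    "zexp i s 1 = of_nat (Suc (Suc i)) powr (- s)"
    by (simp_all add: zexp_def powr_def add.commute add.left_commute del: of_nat_Suc)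
       (simp_all add: ac_simps)
qed

lemma zint_parts:
  "zint i k s = (of_nat (Suc (Suc i)) powr (- s) + s * zint i (Suc k) (s + 1)) / of_nat (Suc k)"
proof -
  have "((\<lambda>x::real. of_nat (Suc k) * (of_real (x ^ k) * zexp i s x)
        - s * (of_real (x ^ Suc k) * zexp i (s + 1) x))
      has_integral of_real (1 ^ Suc k) * zexp i s 1 - of_real (0 ^ Suc k) * zexp i s 0) {0..1}"
  proof (rule fundamental_theorem_of_calculus)
    fix x :: real assume x: "x \<in> {0..1}"
    have 1: "((\<lambda>x. complex_of_real (x ^ Suc k)) has_vector_derivative
         of_real (real (Suc k) * x ^ k)) (at x within {0..1})"
      using DERIV_pow[of "Suc k" x "{0..1}"]
      by (intro has_vector_derivative_of_real)
         (simp add: has_real_derivative_iff_has_vector_derivative mult.commute)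
    show "((\<lambda>x. of_real (x ^ Suc k) * zexp i s x) has_vector_derivative
       of_nat (Suc k) * (of_real (x ^ k) * zexp i s x)
         - s * (of_real (x ^ Suc k) * zexp i (s + 1) x)) (at x within {0..1})"
      using has_vector_derivative_mult[OF 1 zexp_deriv[OF x, of i s]]
      by (rule has_vector_derivative_eq_rhs) (simp add: algebra_simps)
  qed simp
  moreover have "((\<lambda>x::real. of_nat (Suc k) * (of_real (x ^ k) * zexp i s x)
        - s * (of_real (x ^ Suc k) * zexp i (s + 1) x))
      has_integral of_nat (Suc k) * zint i k s - s * zint i (Suc k) (s + 1)) {0..1}"
    by (intro has_integral_diff has_integral_mult_right zint_has_integral)
  ultimately have "of_nat (Suc k) * zint i k s - s * zint i (Suc k) (s + 1) =
      of_nat (Suc (Suc i)) powr (- s)"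
    by (auto dest: has_integral_unique simp: zexp_endpoints simp del: of_nat_Suc)
  then have "of_nat (Suc k) * zint i k s =
      of_nat (Suc (Suc i)) powr (- s) + s * zint i (Suc k) (s + 1)"
    by (simp add: algebra_simps del: of_nat_Suc)
  then show ?thesis by (simp add: eq_divide_eq mult.commute del: of_nat_Suc)
qed

lemma zint_0:
  "(s - 1) * zint i 0 s = of_nat (Suc i) powr (- (s - 1)) - of_nat (Suc (Suc i)) powr (- (s - 1))"
proof -
  have "((\<lambda>x. - (s - 1) * zexp i s x) has_integral zexp i (s - 1) 1 - zexp i (s - 1) 0) {0..1}"
    using zexp_deriv[of _ i "s - 1"] by (intro fundamental_theorem_of_calculus) auto
  moreover have "((\<lambda>x. - (s - 1) * zexp i s x) has_integral - (s - 1) * zint i 0 s) {0..1}"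
    using zint_has_integral[of 0 i s] by (intro has_integral_mult_right) simp
  ultimately have "- (s - 1) * zint i 0 s = zexp i (s - 1) 1 - zexp i (s - 1) 0"
    by (rule has_integral_unique[rotated])
  then show ?thesis unfolding zexp_endpoints by (simp add: algebra_simps del: of_nat_Suc)
qed

lemma norm_Suc_powr: "norm (of_nat (Suc n) powr (- s) :: complex) = real (Suc n) powr (- Re s)"
  using norm_powr_real_powr[of "of_nat (Suc n)" "- s"] by (simp add: add_nonneg_nonneg)

lemma dirichlet_summable: "1 < Re s \<Longrightarrow> summable (\<lambda>n. of_nat (Suc n) powr (- s) :: complex)"
  by (rule summable_comparison_test'[OF summable_Suc_powr[of "Re s"], of 0])
     (auto simp: norm_Suc_powr simp del: of_nat_Suc)

lemma zB_0_0:
  assumes "1 < Re s"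
  shows "zB 0 0 s = 1"
proof -
  have "filterlim (\<lambda>n. real (Suc n)) at_top sequentially"
    by (rule filterlim_compose[OF filterlim_real_sequentially filterlim_Suc])
  then have "(\<lambda>n. real (Suc n) powr (- Re (s - 1))) \<longlonglongrightarrow> 0"
    using assms by (intro tendsto_neg_powr) auto
  then have "(\<lambda>n. of_nat (Suc n) powr (- (s - 1)) :: complex) \<longlonglongrightarrow> 0"
    by (rule tendsto_norm_zero_cancel[OF Lim_transform_eventually])
       (auto simp only: norm_Suc_powr eventually_sequentially)
  from telescope_sums'[OF this] have "(\<lambda>i. (s - 1) * zint i 0 s) sums 1"
    by (simp only: zint_0) simp
  moreover have "(\<lambda>i. (s - 1) * zint i 0 s) sums zB 0 0 s"
    using zint_summable[OF assms] by (auto intro!: sums_mult summable_sums)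
  ultimately show ?thesis by (rule sums_unique2[rotated])
qed

lemma zB_0_step:
  assumes "1 < Re s"
  shows "zB 0 k s = ((s - 1) * ((\<Sum>n. of_nat (Suc n) powr (- s)) - 1) +
           (s - 1) * zB 0 (Suc k) (s + 1)) / of_nat (Suc k)"
proof -
  have "(\<lambda>i. of_nat (Suc (Suc i)) powr (- s) :: complex) sums ((\<Sum>n. of_nat (Suc n) powr (- s)) - 1)"
    using sums_Suc_iff[of "\<lambda>n. of_nat (Suc n) powr (- s) :: complex"]
      summable_sums[OF dirichlet_summable[OF assms]] by (simp del: of_nat_Suc) simp
  moreover have "(\<lambda>i. zint i (Suc k) (s + 1)) sums (\<Sum>i. zint i (Suc k) (s + 1))"
    using assms by (intro summable_sums zint_summable) simp
  ultimately have "(\<lambda>i. (of_nat (Suc (Suc i)) powr (- s) + s * zint i (Suc k) (s + 1)) / of_nat (Suc k))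
     sums (((\<Sum>n. of_nat (Suc n) powr (- s)) - 1 + s * (\<Sum>i. zint i (Suc k) (s + 1))) / of_nat (Suc k))"
    by (intro sums_divide sums_add sums_mult)
  then have "(\<Sum>i. zint i k s) =
     ((\<Sum>n. of_nat (Suc n) powr (- s)) - 1 + s * (\<Sum>i. zint i (Suc k) (s + 1))) / of_nat (Suc k)"
    unfolding zint_parts[of _ k s, symmetric] by (rule sums_unique[symmetric])
  then show ?thesis by (simp add: algebra_simps del: of_nat_Suc)
qed

lemma dirichlet_eq_zB:
  assumes "1 < Re s"
  shows "(s - 1) * ((\<Sum>n. of_nat (Suc n) powr (- s)) - 1) = 1 - (s - 1) * zB 0 1 (s + 1)"
  using zB_0_step[OF assms, of 0] zB_0_0[OF assms] by (simp add: algebra_simps del: zB.simps)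

lemma zB_Suc_eq: "1 - real m < Re s \<Longrightarrow> zB (Suc m) k s = zB m k s"
proof (induction m arbitrary: k s)
  case 0
  then have "1 < Re s" by simp
  then show ?case
    unfolding zB_0_step[OF \<open>1 < Re s\<close>, of k] dirichlet_eq_zB[OF \<open>1 < Re s\<close>]
    by (simp add: algebra_simps del: zB.simps(1) of_nat_Suc)
next
  case (Suc m)
  have "zB (Suc m) j (s + 1) = zB m j (s + 1)" for j using Suc.prems by (intro Suc.IH) simp
  then show ?case by (simp only: zB.simps(2)[of "Suc m"] zB.simps(2)[of m k s])
qed

lemma zB_le_eq:
  assumes "m \<le> n" "1 - real m < Re s"
  shows "zB n k s = zB m k s"
  using assms by (induction n rule: dec_induct) (auto simp: zB_Suc_eq simp del: zB.simps)

lemma zB_holomorphic: "zB m k holomorphic_on {s. 1 - real m < Re s}"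
proof (induction m arbitrary: k)
  case 0
  show ?case by (auto intro!: holomorphic_intros zint_sum_holomorphic)
next
  case (Suc m)
  have "(zB m j \<circ> (\<lambda>s. s + 1)) holomorphic_on {s. 1 - real (Suc m) < Re s}" for j
    by (rule holomorphic_on_compose_gen[OF _ Suc.IH]) (auto intro!: holomorphic_intros)
  then show ?case
    by (auto simp: o_def simp del: of_nat_Suc intro!: holomorphic_intros)
qed

lemma is_zeta_continuation_exists: "\<exists>f. is_zeta_continuation f"
proof -
  define h where "h m s = 1 + (1 - (s - 1) * zB m 1 (s + 1)) / (s - 1)" for m s
  define f where "f s = h (nat \<lceil>1 - Re s\<rceil>) s" for s
  have h_eq: "f s = h m s" if "- real m < Re s" for m s
  proof -
    let ?n = "nat \<lceil>1 - Re s\<rceil>"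
    have "1 - real ?n < Re (s + 1)" "1 - real m < Re (s + 1)" using that by simp_all linarith
    then have "zB ?n 1 (s + 1) = zB m 1 (s + 1)"
      using zB_le_eq[of ?n m "s + 1" 1] zB_le_eq[of m ?n "s + 1" 1] by (metis linear)
    then show ?thesis by (simp add: f_def h_def)
  qed
  have "f holomorphic_on - {1}"
  proof -
    have "f holomorphic_on (\<Union>m. {s. - real m < Re s} \<inter> - {1})"
    proof (rule holomorphic_on_UN_open)
      fix m
      have "(zB m 1 \<circ> (\<lambda>s. s + 1)) holomorphic_on {s. - real m < Re s} \<inter> - {1}"
        by (rule holomorphic_on_compose_gen[OF _ zB_holomorphic]) (auto intro!: holomorphic_intros)
      then have "h m holomorphic_on {s. - real m < Re s} \<inter> - {1}"
        by (auto simp: h_def [abs_def] o_def intro!: holomorphic_intros)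
      then show "f holomorphic_on {s. - real m < Re s} \<inter> - {1}"
        by (rule holomorphic_transform) (auto intro!: h_eq[symmetric])
      show "open ({s. - real m < Re s} \<inter> - {1})"
        by (intro open_Int open_halfspace_Re_gt) auto
    qed
    moreover have "(\<Union>m. {s. - real m < Re s} \<inter> - {1}) = - {1}"
    proof (intro equalityI subsetI)
      fix s :: complex assume "s \<in> - {1}"
      moreover obtain m where "- Re s < real m" using reals_Archimedean2 by blast
      moreover from this have "- real m < Re s" by linarith
      ultimately show "s \<in> (\<Union>m. {s. - real m < Re s} \<inter> - {1})" by blast
    qed auto
    ultimately show ?thesis by simp
  qed
  moreover have "(\<lambda>n. of_nat (Suc n) powr (- s)) sums f s" if s: "1 < Re s" for s
  proof -
    have "s - 1 \<noteq> 0" using s by auto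
    have "f s = 1 + (1 - (s - 1) * zB 0 1 (s + 1)) / (s - 1)"
      using h_eq[of 0 s] s by (simp add: h_def del: zB.simps)
    also have "\<dots> = (\<Sum>n. of_nat (Suc n) powr (- s))"
      unfolding dirichlet_eq_zB[OF s, symmetric]
      by (subst nonzero_mult_div_cancel_left[OF \<open>s - 1 \<noteq> 0\<close>]) simp
    finally have "f s = (\<Sum>n. of_nat (Suc n) powr (- s))" .
    then show ?thesis using summable_sums[OF dirichlet_summable[OF s]] by simp
  qed
  ultimately show ?thesis unfolding is_zeta_continuation_def by blast
qed

lemma is_zeta_continuation_zeta: "is_zeta_continuation zeta"
  unfolding zeta_def using is_zeta_continuation_exists by (rule someI_ex)

lemma is_zeta_continuation_unique:
  assumes "is_zeta_continuation f" "s \<noteq> 1"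
  shows "f s = zeta s"
proof (rule analytic_continuation_open[of "{s. 1 < Re s}" "- {1}" f zeta])
  show "open {s. 1 < Re s}" by (rule open_halfspace_Re_gt)
  have "2 \<in> {s. 1 < Re s}" by simp
  then show "{s. 1 < Re s} \<noteq> {}" by blast
  show "connected (- {1 :: complex})" by (rule connected_punctured_universe) simp
  show "f z = zeta z" if "z \<in> {s. 1 < Re s}" for z
    using that assms(1) is_zeta_continuation_zeta
    unfolding is_zeta_continuation_def by (auto intro: sums_unique2)
qed (use assms is_zeta_continuation_zeta in \<open>auto simp: is_zeta_continuation_def\<close>)

end

theory Submission
  imports Defs
begin

text \<open>Since \<open>cos (n * pi / 2) = 2 * [4 dvd n] - [2 dvd n]\<close>, the terms with \<open>ln 2\<close> cancel and the series
  equals \<open>\<zeta>'(2) / (8 \<pi>\<^sup>2)\<close>.  It remains to express \<open>\<zeta>'(2)\<close> through \<open>\<zeta>'(-1)\<close>, which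
  is the right derivative at \<open>h = 0\<close> of the functional equation relating \<open>\<zeta>(h - 1)\<close> and
  \<open>\<zeta>(2 - h)\<close> for \<open>0 < h < 1\<close>.

  On that interval the trapezoidal rule gives
  \<open>\<zeta>(h - 1) = h (h - 1) / 2 * \<integral>\<^sub>0\<^sup>\<infinity> q(x) x powr (- 1 - h) dx\<close> with \<open>q(x) = frac x - (frac x)\<^sup>2\<close>.
  The Fourier series \<open>q(x) = \<Sum>k. (1 - cos (2 \<pi> k x)) / (\<pi> k)\<^sup>2\<close> has nonnegative terms, so it may be
  integrated termwise, and each integral is a Gamma factor times \<open>(2 \<pi> k) powr h\<close>.\<close>

section \<open>The Mellin transform of \<open>1 - cos\<close>\<close>

lemma nn_integral_powr_exp:
  assumes "0 < s" "0 < (a::real)"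
  shows "(\<integral>\<^sup>+t. ennreal (indicator {0<..} t * (t powr (s - 1) * exp (- a * t))) \<partial>lborel) = ennreal (Gamma s * a powr - s)"
proof -
  have "ennreal (Gamma s) = (\<integral>\<^sup>+t. ennreal (indicator {0<..} t * t powr (s - 1) / exp t) \<partial>lborel)"
    unfolding Gamma_conv_nn_integral_real[OF assms(1)]
    by (intro nn_integral_cong) (auto simp: indicator_def)
  also have "\<dots> = ennreal a * (\<integral>\<^sup>+t. ennreal (indicator {0<..} (a * t) * (a * t) powr (s - 1) / exp (a * t)) \<partial>lborel)"
    using assms by (subst nn_integral_real_affine[where t = 0 and c = a]) auto
  also have "\<dots> = ennreal a * (\<integral>\<^sup>+t. ennreal (a powr (s - 1)) * ennreal (indicator {0<..} t * (t powr (s - 1) * exp (- a * t))) \<partial>lborel)"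
    using assms by (intro arg_cong2[where f = "(*)"] refl nn_integral_cong)
      (auto simp: indicator_def powr_mult exp_minus field_simps zero_less_mult_iff simp flip: ennreal_mult')
  also have "\<dots> = ennreal (a powr s) * (\<integral>\<^sup>+t. ennreal (indicator {0<..} t * (t powr (s - 1) * exp (- a * t))) \<partial>lborel)"
    using assms by (subst nn_integral_cmult) (auto simp: powr_diff mult.assoc [symmetric] simp flip: ennreal_mult')
  finally have "ennreal (a powr - s) * ennreal (Gamma s) = ennreal (a powr - s) * (ennreal (a powr s) * (\<integral>\<^sup>+t. ennreal (indicator {0<..} t * (t powr (s - 1) * exp (- a * t))) \<partial>lborel))"
    by simp
  also have "\<dots> = (\<integral>\<^sup>+t. ennreal (indicator {0<..} t * (t powr (s - 1) * exp (- a * t))) \<partial>lborel)"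
    using assms by (simp add: mult.assoc [symmetric] powr_minus flip: ennreal_mult')
  finally show ?thesis using assms by (simp add: ennreal_mult' mult.commute flip: ennreal_mult')
qed

lemma nn_integral_powr_exp_square:
  assumes "0 < s" "0 < (v::real)"
  shows "(\<integral>\<^sup>+t. ennreal (indicator {0<..} t * (t powr (s - 1) * exp (- v * t\<^sup>2))) \<partial>lborel)
    = ennreal (Gamma (s / 2) / 2 * v powr - (s / 2))"
proof -
  let ?f = "\<lambda>y::real. y powr (s / 2 - 1) / exp y" and ?g = "\<lambda>t. v * t\<^sup>2"
  have im: "?g ` {0<..} = {0<..}"
  proof (intro equalityI subsetI)
    fix y :: real assume "y \<in> {0<..}"
    then have "y = ?g (sqrt (y / v))" "0 < sqrt (y / v)" using assms by auto
    then show "y \<in> ?g ` {0<..}" by blast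
  qed (use assms in auto)
  have "((\<lambda>y. if y \<in> {0<..} then ?f y else 0) has_integral Gamma (s / 2)) {0..}"
    by (rule has_integral_eq[OF _ Gamma_integral_real]) (use assms in auto)
  then have G: "(?f has_integral Gamma (s / 2)) {0<..}"
    by (subst (asm) has_integral_restrict) auto
  from G have "?f absolutely_integrable_on ?g ` {0<..} \<and> integral (?g ` {0<..}) ?f = Gamma (s / 2)"
    unfolding im by (auto intro!: nonnegative_absolutely_integrable_1)
  moreover have "inj_on ?g {0<..}"
    using assms by (auto intro!: inj_onI simp: power2_eq_iff)
  ultimately have "(\<lambda>t. \<bar>2 * v * t\<bar> * ?f (?g t)) absolutely_integrable_on {0<..} \<and>
      integral {0<..} (\<lambda>t. \<bar>2 * v * t\<bar> * ?f (?g t)) = Gamma (s / 2)"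
    by (subst has_absolute_integral_change_of_variables_1')
       (auto intro!: derivative_eq_intros)
  then have "((\<lambda>t. \<bar>2 * v * t\<bar> * ?f (?g t)) has_integral Gamma (s / 2)) {0<..}"
    by (auto simp: has_integral_iff absolutely_integrable_on_def)
  then have "((\<lambda>t. v powr - (s / 2) / 2 * (\<bar>2 * v * t\<bar> * ?f (?g t))) has_integral
      v powr - (s / 2) / 2 * Gamma (s / 2)) {0<..}"
    by (rule has_integral_mult_right)
  moreover have "v powr - (s / 2) / 2 * (\<bar>2 * v * t\<bar> * ?f (?g t)) = t powr (s - 1) * exp (- v * t\<^sup>2)"
    if "t \<in> {0<..}" for t
  proof -
    have "(?g t) powr (s / 2 - 1) = v powr (s / 2) / v * (t powr s / t\<^sup>2)"
      using that assms by (simp add: powr_mult powr_diff powr_powr flip: powr_numeral)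
    then show ?thesis using that assms
      by (simp add: powr_minus powr_diff exp_minus field_simps power2_eq_square)
  qed
  ultimately have "((\<lambda>t. t powr (s - 1) * exp (- v * t\<^sup>2)) has_integral
      v powr - (s / 2) / 2 * Gamma (s / 2)) {0<..}"
    by (rule has_integral_eq[rotated])
  from nn_integral_has_integral_lebesgue[OF _ this] show ?thesis by (simp add: mult_ac)
qed

lemma nn_integral_one_minus_cos_exp:
  assumes "0 < t" "0 < (c::real)"
  shows "(\<integral>\<^sup>+x. ennreal (indicator {0<..} x * ((1 - cos (c * x)) * exp (- x * t))) \<partial>lborel)
    = ennreal (c\<^sup>2 / (t * (c\<^sup>2 + t\<^sup>2)))"
proof -
  define F where "F x = exp (- x * t) * (- 1 / t - (c * sin (c * x) - t * cos (c * x)) / (c\<^sup>2 + t\<^sup>2))" for x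
  have p: "c\<^sup>2 + t\<^sup>2 \<noteq> 0" using assms by (simp add: sum_power2_eq_zero_iff)
  have "(\<integral>\<^sup>+x. ennreal ((1 - cos (c * x)) * exp (- x * t)) * indicator {0..} x \<partial>lborel) = ennreal (0 - F 0)"
  proof (rule nn_integral_FTC_atLeast)
    fix x :: real
    show "(F has_real_derivative (1 - cos (c * x)) * exp (- x * t)) (at x)"
      unfolding F_def using assms p
      by (auto intro!: derivative_eq_intros simp: divide_simps) (auto simp: power2_eq_square algebra_simps)
  next
    have "((\<lambda>x. exp (- x * t)) \<longlongrightarrow> 0) at_top" using assms
      by real_asymp
    moreover have "\<bar>- 1 / t - (c * sin (c * x) - t * cos (c * x)) / (c\<^sup>2 + t\<^sup>2)\<bar> \<le> 1 / t + (c + t) / (c\<^sup>2 + t\<^sup>2)" for x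
    proof -
      have "\<bar>c * sin (c * x) - t * cos (c * x)\<bar> \<le> \<bar>c * sin (c * x)\<bar> + \<bar>t * cos (c * x)\<bar>" by simp
      also have "\<dots> \<le> c * 1 + t * 1" unfolding abs_mult using assms by (intro add_mono mult_mono) auto
      finally have "\<bar>(c * sin (c * x) - t * cos (c * x)) / (c\<^sup>2 + t\<^sup>2)\<bar> \<le> (c + t) / (c\<^sup>2 + t\<^sup>2)"
        unfolding abs_divide by (simp add: divide_right_mono)
      moreover have "\<bar>- 1 / t\<bar> = 1 / t" using assms by simp
      ultimately show ?thesis by linarith
    qed
    ultimately show "(F \<longlongrightarrow> 0) at_top" unfolding F_def
      by (intro lim_null_mult_right_bounded[where B = "1 / t + (c + t) / (c\<^sup>2 + t\<^sup>2)"]) auto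
  qed auto
  moreover have "0 - F 0 = c\<^sup>2 / (t * (c\<^sup>2 + t\<^sup>2))"
    unfolding F_def using assms p by (simp add: divide_simps) (simp add: power2_eq_square algebra_simps)
  moreover have "(\<integral>\<^sup>+x. ennreal (indicator {0<..} x * ((1 - cos (c * x)) * exp (- x * t))) \<partial>lborel)
     = (\<integral>\<^sup>+x. ennreal ((1 - cos (c * x)) * exp (- x * t)) * indicator {0..} x \<partial>lborel)"
    by (intro nn_integral_cong) (auto simp: indicator_def)
  ultimately show ?thesis by simp
qed

text \<open>Both \<open>Gamma (1 + h) * x powr (- 1 - h)\<close> and \<open>1 / (c\<^sup>2 + t\<^sup>2)\<close> are written as Laplace
  integrals; all integrands are nonnegative, so Tonelli applies to each.\<close>

lemma nn_integral_one_minus_cos_powr: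
  assumes "0 < h" "h < 1" "0 < (c::real)"
  shows "(\<integral>\<^sup>+x. ennreal (indicator {0<..} x * ((1 - cos (c * x)) * x powr (- 1 - h))) \<partial>lborel)
    = ennreal (c powr h * Gamma (h / 2) * Gamma (1 - h / 2) / (2 * Gamma (1 + h)))" (is "?I = _")
proof -
  let ?i = "indicator {0<..} :: real \<Rightarrow> real"
  have g: "0 < Gamma (1 + h)" "0 < Gamma (h / 2)" "0 < Gamma (1 - h / 2)"
    using assms by (auto intro: Gamma_real_pos)
  have "ennreal (Gamma (1 + h)) * ?I =
      (\<integral>\<^sup>+x. ennreal (Gamma (1 + h)) * ennreal (?i x * ((1 - cos (c * x)) * x powr (- 1 - h))) \<partial>lborel)"
    by (subst nn_integral_cmult) auto
  also have "\<dots> = (\<integral>\<^sup>+x. \<integral>\<^sup>+t. ennreal (?i x * (1 - cos (c * x)) * (?i t * (t powr h * exp (- x * t)))) \<partial>lborel \<partial>lborel)"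
  proof (rule nn_integral_cong)
    fix x :: real
    show "ennreal (Gamma (1 + h)) * ennreal (?i x * ((1 - cos (c * x)) * x powr (- 1 - h))) =
      (\<integral>\<^sup>+t. ennreal (?i x * (1 - cos (c * x)) * (?i t * (t powr h * exp (- x * t)))) \<partial>lborel)"
    proof (cases "0 < x")
      case True
      have "(\<integral>\<^sup>+t. ennreal (?i x * (1 - cos (c * x)) * (?i t * (t powr h * exp (- x * t)))) \<partial>lborel)
        = (\<integral>\<^sup>+t. ennreal (?i x * (1 - cos (c * x))) * ennreal (?i t * (t powr h * exp (- x * t))) \<partial>lborel)"
        by (intro nn_integral_cong) (auto simp: ennreal_mult' simp del: ennreal_1)
      also have "\<dots> = ennreal (?i x * (1 - cos (c * x))) * ennreal (Gamma (1 + h) * x powr - (1 + h))"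
        using nn_integral_powr_exp[of "1 + h" x] True assms by (subst nn_integral_cmult) auto
      also have "\<dots> = ennreal (Gamma (1 + h)) * ennreal (?i x * ((1 - cos (c * x)) * x powr (- 1 - h)))"
        using g by (simp add: mult_ac flip: ennreal_mult' )
      finally show ?thesis by simp
    qed simp
  qed
  also have "\<dots> = (\<integral>\<^sup>+t. \<integral>\<^sup>+x. ennreal (?i x * (1 - cos (c * x)) * (?i t * (t powr h * exp (- x * t)))) \<partial>lborel \<partial>lborel)"
    by (rule lborel_pair.Fubini') measurable
  also have "\<dots> = (\<integral>\<^sup>+t. ennreal (c\<^sup>2) * ennreal (?i t * (t powr (h - 1) / (c\<^sup>2 + t\<^sup>2))) \<partial>lborel)"
  proof (rule nn_integral_cong)
    fix t :: real
    show "(\<integral>\<^sup>+x. ennreal (?i x * (1 - cos (c * x)) * (?i t * (t powr h * exp (- x * t)))) \<partial>lborel) =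
      ennreal (c\<^sup>2) * ennreal (?i t * (t powr (h - 1) / (c\<^sup>2 + t\<^sup>2)))"
    proof (cases "0 < t")
      case True
      have "(\<integral>\<^sup>+x. ennreal (?i x * (1 - cos (c * x)) * (?i t * (t powr h * exp (- x * t)))) \<partial>lborel)
        = (\<integral>\<^sup>+x. ennreal (t powr h) * ennreal (?i x * ((1 - cos (c * x)) * exp (- x * t))) \<partial>lborel)"
        using True by (intro nn_integral_cong) (auto simp: ennreal_mult' [symmetric] mult_ac)
      also have "\<dots> = ennreal (t powr h) * ennreal (c\<^sup>2 / (t * (c\<^sup>2 + t\<^sup>2)))"
        using nn_integral_one_minus_cos_exp[OF True assms(3)] by (subst nn_integral_cmult) auto
      also have "\<dots> = ennreal (c\<^sup>2) * ennreal (?i t * (t powr (h - 1) / (c\<^sup>2 + t\<^sup>2)))"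
        using True by (simp add: powr_diff flip: ennreal_mult')
      finally show ?thesis .
    qed simp
  qed
  also have "\<dots> = ennreal (c\<^sup>2) * (\<integral>\<^sup>+t. ennreal (?i t * (t powr (h - 1) / (c\<^sup>2 + t\<^sup>2))) \<partial>lborel)"
    by (rule nn_integral_cmult) measurable
  also have "(\<integral>\<^sup>+t. ennreal (?i t * (t powr (h - 1) / (c\<^sup>2 + t\<^sup>2))) \<partial>lborel) =
     (\<integral>\<^sup>+t. \<integral>\<^sup>+v. ennreal (?i t * t powr (h - 1) * (?i v * (exp (- c\<^sup>2 * v) * exp (- v * t\<^sup>2)))) \<partial>lborel \<partial>lborel)"
  proof (rule nn_integral_cong)
    fix t :: real
    have p: "0 < c\<^sup>2 + t\<^sup>2" using assms by (simp add: add_pos_nonneg)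
    have "(\<integral>\<^sup>+v. ennreal (?i t * t powr (h - 1) * (?i v * (exp (- c\<^sup>2 * v) * exp (- v * t\<^sup>2)))) \<partial>lborel) =
      (\<integral>\<^sup>+v. ennreal (?i t * t powr (h - 1)) * ennreal (?i v * (v powr (1 - 1) * exp (- (c\<^sup>2 + t\<^sup>2) * v))) \<partial>lborel)"
      by (intro nn_integral_cong) (auto simp: indicator_def ennreal_mult' [symmetric] algebra_simps simp flip: exp_add)
    also have "\<dots> = ennreal (?i t * t powr (h - 1)) * ennreal (Gamma 1 * (c\<^sup>2 + t\<^sup>2) powr - 1)"
      using nn_integral_powr_exp[of 1 "c\<^sup>2 + t\<^sup>2"] p by (subst nn_integral_cmult) auto
    also have "\<dots> = ennreal (?i t * (t powr (h - 1) / (c\<^sup>2 + t\<^sup>2)))"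
      using p by (simp add: powr_minus divide_simps flip: ennreal_mult')
    finally show "ennreal (?i t * (t powr (h - 1) / (c\<^sup>2 + t\<^sup>2))) =
      (\<integral>\<^sup>+v. ennreal (?i t * t powr (h - 1) * (?i v * (exp (- c\<^sup>2 * v) * exp (- v * t\<^sup>2)))) \<partial>lborel)" ..
  qed
  also have "\<dots> = (\<integral>\<^sup>+v. \<integral>\<^sup>+t. ennreal (?i t * t powr (h - 1) * (?i v * (exp (- c\<^sup>2 * v) * exp (- v * t\<^sup>2)))) \<partial>lborel \<partial>lborel)"
    by (rule lborel_pair.Fubini') measurable
  also have "\<dots> = (\<integral>\<^sup>+v. ennreal (Gamma (h / 2) / 2) * ennreal (?i v * (v powr ((1 - h / 2) - 1) * exp (- c\<^sup>2 * v))) \<partial>lborel)"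
  proof (rule nn_integral_cong)
    fix v :: real
    show "(\<integral>\<^sup>+t. ennreal (?i t * t powr (h - 1) * (?i v * (exp (- c\<^sup>2 * v) * exp (- v * t\<^sup>2)))) \<partial>lborel)
      = ennreal (Gamma (h / 2) / 2) * ennreal (?i v * (v powr ((1 - h / 2) - 1) * exp (- c\<^sup>2 * v)))"
    proof (cases "0 < v")
      case True
      have "(\<integral>\<^sup>+t. ennreal (?i t * t powr (h - 1) * (?i v * (exp (- c\<^sup>2 * v) * exp (- v * t\<^sup>2)))) \<partial>lborel)
       = (\<integral>\<^sup>+t. ennreal (exp (- c\<^sup>2 * v)) * ennreal (?i t * (t powr (h - 1) * exp (- v * t\<^sup>2))) \<partial>lborel)"
        using True by (intro nn_integral_cong) (auto simp: ennreal_mult' [symmetric] mult_ac)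
      also have "\<dots> = ennreal (exp (- c\<^sup>2 * v)) * ennreal (Gamma (h / 2) / 2 * v powr - (h / 2))"
        using nn_integral_powr_exp_square[OF assms(1) True] by (subst nn_integral_cmult) auto
      also have "\<dots> = ennreal (Gamma (h / 2) / 2) * ennreal (?i v * (v powr ((1 - h / 2) - 1) * exp (- c\<^sup>2 * v)))"
        using True g by (simp add: mult_ac flip: ennreal_mult')
      finally show ?thesis .
    qed simp
  qed
  also have "\<dots> = ennreal (Gamma (h / 2) / 2) * ennreal (Gamma (1 - h / 2) * (c\<^sup>2) powr - (1 - h / 2))"
    using nn_integral_powr_exp[of "1 - h / 2" "c\<^sup>2"] assms by (subst nn_integral_cmult) auto
  also have "(c\<^sup>2) powr - (1 - h / 2) = c powr h / c\<^sup>2"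
  proof -
    have "(c\<^sup>2) powr - (1 - h / 2) = c powr (h - 2)"
      using assms by (simp add: powr_powr flip: powr_numeral)
    also have "\<dots> = c powr h / c\<^sup>2" using assms by (simp add: powr_diff)
    finally show ?thesis .
  qed
  also have "ennreal (c\<^sup>2) * (ennreal (Gamma (h / 2) / 2) * ennreal (Gamma (1 - h / 2) * (c powr h / c\<^sup>2))) =
      ennreal (c powr h * Gamma (h / 2) * Gamma (1 - h / 2) / 2)"
    using g assms by (simp flip: ennreal_mult')
  finally have e: "ennreal (Gamma (1 + h)) * ?I = ennreal (c powr h * Gamma (h / 2) * Gamma (1 - h / 2) / 2)" .
  have "?I = ennreal (1 / Gamma (1 + h)) * (ennreal (Gamma (1 + h)) * ?I)"
    using g by (simp add: mult.assoc [symmetric] flip: ennreal_mult')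
  also have "\<dots> = ennreal (c powr h * Gamma (h / 2) * Gamma (1 - h / 2) / (2 * Gamma (1 + h)))"
    unfolding e using g by (subst ennreal_mult' [symmetric]) auto
  finally show ?thesis .
qed

section \<open>The Fourier series of the periodic parabola\<close>

lemma dirichlet_kernel:
  "sin (pi * x) * (1 + 2 * (\<Sum>k<n. cos (2 * pi * real (Suc k) * x))) = sin ((2 * real n + 1) * pi * x)"
proof (induction n)
  case (Suc n)
  have "2 * sin (pi * x) * cos (2 * pi * real (Suc n) * x) =
      sin (pi * x + 2 * pi * real (Suc n) * x) + sin (pi * x - 2 * pi * real (Suc n) * x)"
    by (simp only: sin_add sin_diff)
  also have "\<dots> = sin ((2 * real (Suc n) + 1) * pi * x) - sin ((2 * real n + 1) * pi * x)"
  proof -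
    have "pi * x + 2 * pi * real (Suc n) * x = (2 * real (Suc n) + 1) * pi * x"
      "pi * x - 2 * pi * real (Suc n) * x = - ((2 * real n + 1) * pi * x)"
      by (simp_all add: algebra_simps)
    then show ?thesis by (simp only: sin_minus)
  qed
  finally show ?case using Suc.IH by (simp add: algebra_simps)
qed simp

definition fourier_error :: "nat \<Rightarrow> real \<Rightarrow> real" where
  "fourier_error n x =
     (\<Sum>k<n. (1 - cos (2 * pi * real (Suc k) * x)) / (pi\<^sup>2 * (real (Suc k))\<^sup>2)) - (x - x\<^sup>2)"

definition fourier_error' :: "nat \<Rightarrow> real \<Rightarrow> real" where
  "fourier_error' n x = (\<Sum>k<n. 2 * sin (2 * pi * real (Suc k) * x) / (pi * real (Suc k))) - (1 - 2 * x)"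

lemma fourier_error_deriv:
  "(fourier_error n has_real_derivative fourier_error' n x) (at x)"
proof -
  have "((\<lambda>x. (1 - cos (2 * pi * m * x)) / (pi\<^sup>2 * m\<^sup>2)) has_real_derivative
      2 * sin (2 * pi * m * x) / (pi * m)) (at x)" if "m \<noteq> 0" for m
    using that by (auto intro!: derivative_eq_intros simp: field_simps power2_eq_square)
  then show ?thesis
    unfolding fourier_error_def [abs_def] fourier_error'_def
    by (intro DERIV_diff DERIV_sum) (auto intro!: derivative_eq_intros simp del: of_nat_Suc)
qed

lemma fourier_error'_deriv:
  assumes "sin (pi * x) \<noteq> 0"
  shows "(fourier_error' n has_real_derivative 2 * sin ((2 * real n + 1) * pi * x) / sin (pi * x)) (at x)"
proof -
  have "(fourier_error' n has_real_derivative 2 * (1 + 2 * (\<Sum>k<n. cos (2 * pi * real (Suc k) * x)))) (at x)"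
    unfolding fourier_error'_def [abs_def]
    by (auto intro!: derivative_eq_intros sum.cong simp: sum_distrib_left simp del: of_nat_Suc)
  then show ?thesis
    by (rule DERIV_cong) (use assms in \<open>simp only: dirichlet_kernel [symmetric], simp\<close>)
qed

lemma sin_ge_on_subinterval:
  assumes "0 < d" "d \<le> 1 / 2" "x \<in> {d..1 - d}"
  shows "sin (pi * d) \<le> sin (pi * x)"
proof (cases "x \<le> 1 / 2")
  case True
  then have "pi * d \<le> pi * x" "pi * x \<le> pi * (1 / 2)" "0 \<le> pi * d"
    using assms by (auto intro!: mult_left_mono)
  then show ?thesis by (intro sin_monotone_2pi_le) (use pi_gt_zero in linarith)+
next
  case False
  then have "pi * d \<le> pi * (1 - x)" "pi * (1 - x) \<le> pi * (1 / 2)" "0 \<le> pi * d"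
    using assms by (auto intro!: mult_left_mono)
  then have "sin (pi * d) \<le> sin (pi * (1 - x))" by (intro sin_monotone_2pi_le) (use pi_gt_zero in linarith)+
  also have "sin (pi * (1 - x)) = sin (pi * x)" by (simp add: right_diff_distrib sin_diff)
  finally show ?thesis .
qed

text \<open>Subtracting the leading oscillating term of the primitive of the Dirichlet kernel leaves a
  function whose derivative is \<open>O(1 / n)\<close>.\<close>

lemma fourier_error'_bound:
  assumes d: "0 < d" "d \<le> 1 / 2" and x: "x \<in> {d..1 - d}"
  shows "\<bar>fourier_error' n x\<bar> \<le> (2 / (sin (pi * d))\<^sup>2 + 2 / sin (pi * d)) / (2 * real n + 1)"
proof -
  define N where "N = 2 * real n + 1"
  have N: "N > 0" by (simp add: N_def)
  define \<sigma> where "\<sigma> = sin (pi * d)"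
  have \<sigma>: "0 < \<sigma>" unfolding \<sigma>_def using d by (intro sin_gt_zero) auto
  have s: "\<sigma> \<le> sin (pi * y)" if "y \<in> {d..1 - d}" for y
    unfolding \<sigma>_def using sin_ge_on_subinterval[OF d that] .
  define C where "C y = fourier_error' n y + 2 / (N * pi) * (cos (N * pi * y) / sin (pi * y))" for y
  have C: "(C has_real_derivative - (2 / N) * (cos (N * pi * y) * cos (pi * y) / (sin (pi * y))\<^sup>2)) (at y within {d..1 - d})"
    if y: "y \<in> {d..1 - d}" for y
  proof -
    have "sin (pi * y) \<noteq> 0" using s[OF y] \<sigma> by auto
    note 1 = fourier_error'_deriv[OF this, of n, folded N_def]
    from \<open>sin (pi * y) \<noteq> 0\<close>
    have 2: "((\<lambda>y. cos (N * pi * y) / sin (pi * y)) has_real_derivative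
      - (N * pi) * (sin (N * pi * y) / sin (pi * y)) - pi * (cos (N * pi * y) * cos (pi * y) / (sin (pi * y))\<^sup>2)) (at y)"
      by (auto intro!: derivative_eq_intros simp: divide_simps power2_eq_square)
    have "(C has_real_derivative - (2 / N) * (cos (N * pi * y) * cos (pi * y) / (sin (pi * y))\<^sup>2)) (at y)"
      unfolding C_def using N
      by (intro DERIV_cong[OF DERIV_add[OF 1 DERIV_cmult[OF 2]]]) (simp add: right_diff_distrib)
    then show ?thesis by (rule DERIV_subset) auto
  qed
  have "norm (C x - C (1 / 2)) \<le> (2 / N / \<sigma>\<^sup>2) * norm (x - 1 / 2)"
  proof (rule field_differentiable_bound[OF _ C])
    fix y assume y: "y \<in> {d..1 - d}"
    have "\<bar>cos (N * pi * y) * cos (pi * y)\<bar> \<le> 1 * 1" unfolding abs_mult by (intro mult_mono) auto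
    moreover have "\<sigma>\<^sup>2 \<le> (sin (pi * y))\<^sup>2" using s[OF y] \<sigma> by (intro power_mono) auto
    ultimately have "\<bar>cos (N * pi * y) * cos (pi * y)\<bar> / (sin (pi * y))\<^sup>2 \<le> 1 / \<sigma>\<^sup>2"
      using \<sigma> by (intro frac_le) auto
    then have "(2 / N) * (\<bar>cos (N * pi * y) * cos (pi * y)\<bar> / (sin (pi * y))\<^sup>2) \<le> (2 / N) * (1 / \<sigma>\<^sup>2)"
      using N by (intro mult_left_mono) auto
    then show "norm (- (2 / N) * (cos (N * pi * y) * cos (pi * y) / (sin (pi * y))\<^sup>2)) \<le> 2 / N / \<sigma>\<^sup>2"
      using N by (simp add: abs_mult abs_divide)
  qed (use d x in auto)
  also have "\<dots> \<le> (2 / N / \<sigma>\<^sup>2) * 1" using x d N by (intro mult_left_mono) auto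
  finally have 1: "\<bar>C x - C (1 / 2)\<bar> \<le> 2 / N / \<sigma>\<^sup>2" by simp
  have "sin (pi * real (Suc k)) = 0" for k by (rule sin_npi2)
  then have "fourier_error' n (1 / 2) = 0"
    unfolding fourier_error'_def by (simp add: mult.assoc del: of_nat_Suc)
  moreover have "cos (N * pi * (1 / 2)) = 0"
    unfolding cos_zero_iff_int N_def by (intro exI[of _ "2 * int n + 1"]) auto
  ultimately have 2: "C (1 / 2) = 0" by (simp add: C_def)
  have "\<bar>cos (N * pi * x) / sin (pi * x)\<bar> \<le> 1 / \<sigma>"
    unfolding abs_divide using s[OF x] \<sigma> by (intro frac_le) auto
  then have "2 / (N * pi) * \<bar>cos (N * pi * x) / sin (pi * x)\<bar> \<le> 2 / N * (1 / \<sigma>)"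
    using N \<sigma> pi_gt3 by (intro mult_mono frac_le) (auto simp: field_simps)
  then have "\<bar>2 / (N * pi) * (cos (N * pi * x) / sin (pi * x))\<bar> \<le> 2 / N / \<sigma>"
    using N by (simp add: abs_mult)
  then have "\<bar>fourier_error' n x\<bar> \<le> 2 / N / \<sigma>\<^sup>2 + 2 / N / \<sigma>"
    using 1 2 unfolding C_def by linarith
  then show ?thesis by (simp add: N_def \<sigma>_def add_divide_distrib mult.commute)
qed

lemma inverse_squares_summable: "summable (\<lambda>k. 2 / (pi\<^sup>2 * (real (Suc k))\<^sup>2))"
  using summable_mult[OF sums_summable[OF inverse_squares_sums], of "2 / pi\<^sup>2"]
  by (simp add: add.commute)

lemma fourier_term_bound:
  "norm ((1 - cos (2 * pi * real (Suc k) * x)) / (pi\<^sup>2 * (real (Suc k))\<^sup>2)) \<le> 2 / (pi\<^sup>2 * (real (Suc k))\<^sup>2)"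
proof -
  have "\<bar>1 - cos (2 * pi * real (Suc k) * x)\<bar> \<le> 2"
    using cos_ge_minus_one[of "2 * pi * real (Suc k) * x"] cos_le_one[of "2 * pi * real (Suc k) * x"] by linarith
  then show ?thesis by (simp add: divide_right_mono abs_divide del: of_nat_Suc)
qed

lemma fourier_periodic_parabola:
  assumes x: "0 \<le> x" "x \<le> 1"
  shows "(\<lambda>k. (1 - cos (2 * pi * real (Suc k) * x)) / (pi\<^sup>2 * (real (Suc k))\<^sup>2)) sums (x - x\<^sup>2)"
proof -
  define E where "E x = (\<Sum>k. (1 - cos (2 * pi * real (Suc k) * x)) / (pi\<^sup>2 * (real (Suc k))\<^sup>2)) - (x - x\<^sup>2)" for x
  have sm: "summable (\<lambda>k. (1 - cos (2 * pi * real (Suc k) * y)) / (pi\<^sup>2 * (real (Suc k))\<^sup>2))" for y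
    by (rule summable_comparison_test'[OF inverse_squares_summable fourier_term_bound])
  have lim: "(\<lambda>n. fourier_error n y) \<longlonglongrightarrow> E y" for y
    unfolding fourier_error_def E_def by (intro tendsto_diff summable_LIMSEQ sm tendsto_const)
  have ul: "uniform_limit UNIV (\<lambda>n y. \<Sum>k<n. (1 - cos (2 * pi * real (Suc k) * y)) / (pi\<^sup>2 * (real (Suc k))\<^sup>2))
      (\<lambda>y. \<Sum>k. (1 - cos (2 * pi * real (Suc k) * y)) / (pi\<^sup>2 * (real (Suc k))\<^sup>2)) sequentially"
    by (rule Weierstrass_m_test[OF _ inverse_squares_summable]) (rule fourier_term_bound)
  have "continuous_on UNIV (\<lambda>y. \<Sum>k. (1 - cos (2 * pi * real (Suc k) * y)) / (pi\<^sup>2 * (real (Suc k))\<^sup>2))"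
    by (rule uniform_limit_theorem[OF _ ul]) (auto intro!: always_eventually continuous_intros simp del: of_nat_Suc)
  then have cont: "continuous_on UNIV E" unfolding E_def by (intro continuous_intros) auto
  have const: "E y = E (1 / 2)" if y: "y \<in> {0<..<1}" for y
  proof -
    define d where "d = min y (1 - y)"
    have d: "0 < d" "d \<le> 1 / 2" "y \<in> {d..1 - d}" "1 / 2 \<in> {d..1 - d}" using y by (auto simp: d_def min_def)
    define K where "K = 2 / (sin (pi * d))\<^sup>2 + 2 / sin (pi * d)"
    have "norm (fourier_error n y - fourier_error n (1 / 2)) \<le> K / (2 * real n + 1) * norm (y - 1 / 2)" for n
    proof (rule field_differentiable_bound[OF _ DERIV_subset[OF fourier_error_deriv]])
      show "norm (fourier_error' n z) \<le> K / (2 * real n + 1)" if "z \<in> {d..1 - d}" for z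
        using fourier_error'_bound[OF d(1,2) that, of n] by (simp add: K_def)
    qed (use d in auto)
    then have "\<forall>\<^sub>F n in sequentially. norm (fourier_error n y - fourier_error n (1 / 2)) \<le>
        K * norm (y - 1 / 2) * (1 / (2 * real n + 1))"
      by (intro always_eventually allI) (simp add: mult.commute)
    moreover have "(\<lambda>n. 1 / (2 * real n + 1)) \<longlonglongrightarrow> 0" by real_asymp
    ultimately have "(\<lambda>n. fourier_error n y - fourier_error n (1 / 2)) \<longlonglongrightarrow> 0"
      by (rule Lim_null_comparison[OF _ tendsto_mult_right_zero])
    from LIMSEQ_unique[OF this tendsto_diff[OF lim lim]] show ?thesis by simp
  qed
  have "E y = E (1 / 2)" if "y \<in> closure {0<..<1}" for y
    by (rule continuous_constant_on_closure[OF continuous_on_subset[OF cont] const that]) auto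
  from this[of x] this[of 0] have "E x = E 0" using x by simp
  also have "E 0 = 0" by (simp add: E_def)
  finally show ?thesis using summable_sums[OF sm[of x]] by (simp add: E_def)
qed

section \<open>The zeta function to the left of the line \<open>Re s = 1\<close>\<close>

definition trapezoid_defect :: "complex \<Rightarrow> complex" where
  "trapezoid_defect s = (\<Sum>i. zint i 1 s) - (\<Sum>i. zint i 2 s)"

lemma zint_trapezoid:
  "zint i 0 s = (of_nat (Suc i) powr (- s) + of_nat (Suc (Suc i)) powr (- s)) / 2
     - s * (s + 1) / 2 * (zint i 1 (s + 2) - zint i 2 (s + 2))"
proof -
  have a: "zint i 0 s = of_nat (Suc (Suc i)) powr (- s) + s * zint i 1 (s + 1)"
    using zint_parts[of i 0 s] by simp
  have b: "zint i 1 (s + 1) = (of_nat (Suc (Suc i)) powr (- (s + 1)) + (s + 1) * zint i 2 (s + 2)) / 2"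
    using zint_parts[of i 1 "s + 1"] by (simp add: numeral_2_eq_2 add.assoc)
  have c: "zint i 0 (s + 1) = of_nat (Suc (Suc i)) powr (- (s + 1)) + (s + 1) * zint i 1 (s + 2)"
    using zint_parts[of i 0 "s + 1"] by (simp add: add.assoc)
  have d: "s * zint i 0 (s + 1) = of_nat (Suc i) powr (- s) - of_nat (Suc (Suc i)) powr (- s)"
    using zint_0[of "s + 1" i] by simp
  show ?thesis using a b c d by algebra
qed

lemma zeta_eq_trapezoid:
  assumes "- 1 < Re s" "s \<noteq> 1"
  shows "zeta s = 1 / (s - 1) + 1 / 2 + s * (s + 1) / 2 * trapezoid_defect (s + 2)"
proof (rule analytic_continuation_open[of "{s. 1 < Re s}" "{s. - 1 < Re s} - {1}" zeta])
  show "open {s. 1 < Re s}" "open ({s. - 1 < Re s} - {1})"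
    by (auto intro!: open_Diff open_halfspace_Re_gt)
  have "2 \<in> {s. 1 < Re s}" by simp
  then show "{s. 1 < Re s} \<noteq> {}" by blast
  show "connected ({s. - 1 < Re s} - {1})"
    by (intro connected_open_delete open_halfspace_Re_gt convex_connected convex_halfspace_Re_gt) simp
  show "zeta holomorphic_on ({s. - 1 < Re s} - {1})"
    using is_zeta_continuation_zeta
    by (auto simp: is_zeta_continuation_def intro: holomorphic_on_subset)
  have "((\<lambda>s. \<Sum>i. zint i k s) \<circ> (\<lambda>s. s + 2)) holomorphic_on ({s. - 1 < Re s} - {1})" for k
    by (rule holomorphic_on_compose_gen[OF _ zint_sum_holomorphic]) (auto intro!: holomorphic_intros)
  then show "(\<lambda>s. 1 / (s - 1) + 1 / 2 + s * (s + 1) / 2 * trapezoid_defect (s + 2))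
      holomorphic_on ({s. - 1 < Re s} - {1})"
    unfolding trapezoid_defect_def o_def by (intro holomorphic_intros) auto
next
  fix s assume "s \<in> {s. 1 < Re s}"
  then have s: "1 < Re s" by simp
  then have s1: "s - 1 \<noteq> 0" by auto
  have z: "(\<lambda>n. of_nat (Suc n) powr (- s)) sums zeta s"
    using is_zeta_continuation_zeta s by (auto simp: is_zeta_continuation_def)
  then have z': "(\<lambda>n. of_nat (Suc (Suc n)) powr (- s)) sums (zeta s - 1)"
    using sums_Suc_iff[of "\<lambda>n. of_nat (Suc n) powr (- s)" "zeta s - 1"] by (simp del: of_nat_Suc) simp
  have m: "(\<lambda>i. zint i k (s + 2)) sums (\<Sum>i. zint i k (s + 2))" for k
    using s by (intro summable_sums zint_summable) simp
  have "(\<lambda>i. zint i 0 s) sums ((zeta s + (zeta s - 1)) / 2 - s * (s + 1) / 2 * trapezoid_defect (s + 2))"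
    unfolding zint_trapezoid trapezoid_defect_def by (intro sums_diff sums_divide sums_add sums_mult z z' m)
  then have "(\<Sum>i. zint i 0 s) = zeta s - 1 / 2 - s * (s + 1) / 2 * trapezoid_defect (s + 2)"
    by (simp add: sums_iff)
  moreover have "(\<Sum>i. zint i 0 s) = 1 / (s - 1)"
    using zB_0_0[OF s] s1 by (simp add: field_simps)
  ultimately show "zeta s = 1 / (s - 1) + 1 / 2 + s * (s + 1) / 2 * trapezoid_defect (s + 2)"
    by simp
qed (use assms in auto)

lemma zint_defect_of_real:
  fixes a :: real
  shows "zint i 1 (of_real a) - zint i 2 (of_real a) =
    of_real (integral {0..1} (\<lambda>x. (x - x\<^sup>2) * (real i + 1 + x) powr (- a)))"
    "((\<lambda>x. (x - x\<^sup>2) * (real i + 1 + x) powr (- a)) has_integral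
      integral {0..1} (\<lambda>x. (x - x\<^sup>2) * (real i + 1 + x) powr (- a))) {0..1}"
proof -
  let ?f = "\<lambda>x. (x - x\<^sup>2) * (real i + 1 + x) powr (- a)"
  show i: "(?f has_integral integral {0..1} ?f) {0..1}"
    by (intro integrable_integral integrable_continuous_interval continuous_intros) auto
  have "((\<lambda>x. of_real (x ^ 1) * zexp i (of_real a) x - of_real (x ^ 2) * zexp i (of_real a) x)
     has_integral zint i 1 (of_real a) - zint i 2 (of_real a)) {0..1}"
    by (intro has_integral_diff zint_has_integral)
  moreover have "of_real (x ^ 1) * zexp i (of_real a) x - of_real (x ^ 2) * zexp i (of_real a) x
     = complex_of_real (?f x)" if "x \<in> {0..1}" for x
  proof -
    have "zexp i (of_real a) x = of_real (exp (- a * ln (real i + 1 + x)))"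
      unfolding zexp_def by (simp flip: exp_of_real)
    also have "exp (- a * ln (real i + 1 + x)) = (real i + 1 + x) powr (- a)"
      using that by (simp add: powr_def)
    finally show ?thesis by (simp add: algebra_simps)
  qed
  ultimately have "((\<lambda>x. complex_of_real (?f x)) has_integral zint i 1 (of_real a) - zint i 2 (of_real a)) {0..1}"
    by (rule has_integral_eq[rotated])
  moreover have "((\<lambda>x. complex_of_real (?f x)) has_integral of_real (integral {0..1} ?f)) {0..1}"
    using has_integral_linear[OF i bounded_linear_of_real] by (simp add: o_def)
  ultimately show "zint i 1 (of_real a) - zint i 2 (of_real a) = of_real (integral {0..1} ?f)"
    by (rule has_integral_unique)
qed

lemma nn_integral_periodic_parabola:
  assumes "0 < h" "h < (1::real)"
  obtains r :: real where "0 \<le> r" "(\<integral>\<^sup>+x. ennreal (indicator {0<..} x * ((frac x - (frac x)\<^sup>2) * x powr (- 1 - h))) \<partial>lborel) = ennreal r"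
    "zeta (of_real (h - 1)) = of_real ((h - 1) * h / 2 * r)"
proof -
  define p where "p x = x - x\<^sup>2" for x :: real
  have p0: "0 \<le> p x" if "0 \<le> x" "x \<le> 1" for x
    using mult_left_mono[of x 1 x] that by (simp add: p_def power2_eq_square)
  define J where "J i = integral {0..1} (\<lambda>x. p x * (real i + 1 + x) powr (- 1 - h))" for i
  have J: "((\<lambda>x. p x * (real i + 1 + x) powr (- 1 - h)) has_integral J i) {0..1}" for i
    using zint_defect_of_real(2)[of i "1 + h"] by (simp add: p_def J_def)
  have J0: "0 \<le> J i" for i
    by (rule has_integral_nonneg[OF J]) (use p0 in auto)
  have Jz: "zint i 1 (of_real (1 + h)) - zint i 2 (of_real (1 + h)) = of_real (J i)" for i
    using zint_defect_of_real(1)[of i "1 + h"] by (simp add: p_def J_def)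
  have "(\<lambda>i. zint i k (of_real (1 + h))) sums (\<Sum>i. zint i k (of_real (1 + h)))" for k
    using assms by (intro summable_sums zint_summable) simp
  from sums_diff[OF this[of 1] this[of 2]]
  have "(\<lambda>i. complex_of_real (J i)) sums trapezoid_defect (of_real (1 + h))"
    unfolding trapezoid_defect_def Jz .
  then have JS: "summable J" "trapezoid_defect (of_real (1 + h)) = of_real (suminf J)"
    by (auto simp: sums_iff summable_of_real_iff suminf_of_real)
  \<comment> \<open>At \<open>s = h - 1\<close> the first period contributes \<open>s * (s + 1) / 2 * J' = 1 / (s - 1) + 1 / 2\<close>.\<close>
  define J' where "J' = 1 / (1 - h) - 1 / (2 - h)"
  have J': "((\<lambda>x. p x * x powr (- 1 - h)) has_integral 1 / (1 - h) - 1 / (2 - h)) {0..1}"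
  proof (rule has_integral_eq)
    show "((\<lambda>x. x powr (- h) - x powr (1 - h)) has_integral 1 / (1 - h) - 1 / (2 - h)) {0..1}"
      using has_integral_diff[OF has_integral_powr_from_0[of "- h" 1] has_integral_powr_from_0[of "1 - h" 1]] assms
      by simp
    show "x powr (- h) - x powr (1 - h) = p x * x powr (- 1 - h)" if "x \<in> {0..1}" for x
      using that by (cases "x = 0") (auto simp: p_def powr_diff powr_minus power2_eq_square field_simps)
  qed
  have J'0: "0 \<le> 1 / (1 - h) - 1 / (2 - h)" using assms by (simp add: frac_le)
  define G where "G x = ennreal (indicator {0<..} x * ((frac x - (frac x)\<^sup>2) * x powr (- 1 - h)))" for x :: real
  have [measurable]: "(frac :: real \<Rightarrow> real) \<in> borel_measurable borel"
    unfolding frac_def [abs_def] by measurable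
  have G [measurable]: "G \<in> borel_measurable borel"
    unfolding G_def [abs_def] by measurable
  have piece: "(\<integral>\<^sup>+x. G x * indicator {real n..<real n + 1} x \<partial>lborel) = ennreal v"
    if v: "((\<lambda>x. p x * (real n + x) powr (- 1 - h)) has_integral v) {0..1}" for n v
  proof -
    have "(\<integral>\<^sup>+x. G x * indicator {real n..<real n + 1} x \<partial>lborel) =
       (\<integral>\<^sup>+x. G (real n + 1 * x) * indicator {real n..<real n + 1} (real n + 1 * x) \<partial>lborel)"
      by (subst nn_integral_real_affine[where c = 1 and t = "real n"]) auto
    also have "\<dots> = (\<integral>\<^sup>+x. ennreal (indicator {0..1} x * (p x * (real n + x) powr (- 1 - h))) \<partial>lborel)"
    proof (rule nn_integral_cong)
      fix x :: real
      consider "x < 0" | "1 < x" | "x = 1" | "x = 0" | "0 < x" "x < 1" by linarith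
      then show "G (real n + 1 * x) * indicator {real n..<real n + 1} (real n + 1 * x) =
        ennreal (indicator {0..1} x * (p x * (real n + x) powr (- 1 - h)))"
      proof cases
        case 5
        then have "frac x = x" by (simp add: frac_eq)
        moreover have "frac (real n + x) = frac x" by (simp add: frac_def)
        ultimately show ?thesis using 5 by (simp add: G_def p_def)
      qed (auto simp: G_def p_def frac_def)
    qed
    also have "\<dots> = ennreal v"
      by (rule nn_integral_has_integral_lebesgue[OF _ v]) (use p0 in auto)
    finally show ?thesis .
  qed
  have "(\<integral>\<^sup>+x. G x \<partial>lborel) = (\<integral>\<^sup>+x. (\<Sum>n. G x * indicator {real n..<real n + 1} x) \<partial>lborel)"
  proof (rule nn_integral_cong)
    fix x :: real
    show "G x = (\<Sum>n. G x * indicator {real n..<real n + 1} x)"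
    proof (cases "0 < x")
      case True
      define m where "m = nat \<lfloor>x\<rfloor>"
      have m: "x \<in> {real n..<real n + 1} \<longleftrightarrow> n = m" for n
        using True unfolding m_def by (simp add: floor_eq_iff nat_eq_iff2)
      have "(\<Sum>n. G x * indicator {real n..<real n + 1} x) = (\<Sum>n. if n = m then G x else 0)"
        unfolding indicator_def m by (intro suminf_cong) simp
      then show ?thesis using sums_single[of m "\<lambda>_. G x"] by (simp add: sums_iff)
    qed (simp add: G_def)
  qed
  also have "\<dots> = (\<Sum>n. \<integral>\<^sup>+x. G x * indicator {real n..<real n + 1} x \<partial>lborel)"
    by (rule nn_integral_suminf) auto
  also have "\<dots> = (\<Sum>n. ennreal (case n of 0 \<Rightarrow> J' | Suc i \<Rightarrow> J i))"
  proof (rule suminf_cong)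
    fix n
    show "(\<integral>\<^sup>+x. G x * indicator {real n..<real n + 1} x \<partial>lborel) = ennreal (case n of 0 \<Rightarrow> J' | Suc i \<Rightarrow> J i)"
      using J' J by (intro piece) (auto simp: J'_def add.commute split: nat.split)
  qed
  also have "\<dots> = ennreal (J' + suminf J)"
  proof (rule suminf_ennreal_eq)
    show "(\<lambda>n. case n of 0 \<Rightarrow> J' | Suc i \<Rightarrow> J i) sums (J' + suminf J)"
      using summable_sums[OF JS(1)] sums_Suc_iff[of "\<lambda>n. case n of 0 \<Rightarrow> J' | Suc i \<Rightarrow> J i" "suminf J"]
      by (simp add: add.commute)
  qed (use J0 J'0 in \<open>auto simp: J'_def split: nat.split\<close>)
  finally have 1: "(\<integral>\<^sup>+x. G x \<partial>lborel) = ennreal (J' + suminf J)" .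
  have e: "complex_of_real (h - 1) + 2 = of_real (1 + h)" by simp
  have "zeta (of_real (h - 1)) = 1 / (of_real (h - 1) - 1) + 1 / 2 + of_real (h - 1) * (of_real (h - 1) + 1) / 2 * of_real (suminf J)"
    using assms zeta_eq_trapezoid[of "of_real (h - 1)"] unfolding e JS(2) by (simp add: complex_eq_iff)
  also have "\<dots> = of_real (1 / (h - 1 - 1) + 1 / 2 + (h - 1) * h / 2 * suminf J)"
    by simp
  also have "1 / (h - 1 - 1) + 1 / 2 + (h - 1) * h / 2 * suminf J = (h - 1) * h / 2 * (J' + suminf J)"
    using assms by (simp add: J'_def divide_simps) (simp add: algebra_simps)
  finally have 2: "zeta (of_real (h - 1)) = of_real ((h - 1) * h / 2 * (J' + suminf J))" .
  show ?thesis
    by (rule that[OF _ 1[unfolded G_def] 2]) (use J'0 J0 JS(1) in \<open>auto simp: J'_def suminf_nonneg\<close>)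
qed

section \<open>The functional equation and the derivatives at \<open>2\<close> and \<open>- 1\<close>\<close>

lemma zeta_of_real_sums:
  assumes "1 < a"
  shows "zeta (of_real a) = of_real (\<Sum>n. real (Suc n) powr - a)"
proof -
  have "(\<lambda>n. of_nat (Suc n) powr (- of_real a)) sums zeta (of_real a)"
    using is_zeta_continuation_zeta assms by (auto simp: is_zeta_continuation_def)
  moreover have "of_nat (Suc n) powr (- of_real a) = complex_of_real (real (Suc n) powr - a)" for n
    using powr_of_real[of "real (Suc n)" "- a"] by (simp add: add_nonneg_nonneg)
  ultimately have "(\<lambda>n. complex_of_real (real (Suc n) powr - a)) sums zeta (of_real a)"
    by simp
  moreover have "(\<lambda>n. complex_of_real (real (Suc n) powr - a)) sums of_real (\<Sum>n. real (Suc n) powr - a)"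
    unfolding sums_of_real_iff by (intro summable_sums summable_Suc_powr assms)
  ultimately show ?thesis by (rule sums_unique2)
qed

lemma zeta_functional_equation_strip:
  assumes "0 < h" "h < (1::real)"
  shows "zeta (of_real (h - 1)) * of_real (Gamma (1 + h)) =
    of_real ((h - 1) / (2 * pi\<^sup>2) * (2 * pi) powr h * Gamma (1 + h / 2) * Gamma (1 - h / 2)) * zeta (of_real (2 - h))"
proof -
  obtain r :: real where r: "0 \<le> r"
    "(\<integral>\<^sup>+x. ennreal (indicator {0<..} x * ((frac x - (frac x)\<^sup>2) * x powr (- 1 - h))) \<partial>lborel) = ennreal r"
    "zeta (of_real (h - 1)) = of_real ((h - 1) * h / 2 * r)"
    using nn_integral_periodic_parabola[OF assms] .
  define C where "C = Gamma (h / 2) * Gamma (1 - h / 2) / (2 * Gamma (1 + h))"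
  have C: "0 \<le> C" using assms unfolding C_def
    by (intro divide_nonneg_nonneg mult_nonneg_nonneg) (auto intro!: less_imp_le[OF Gamma_real_pos])
  define Z where "Z = (\<Sum>n. real (Suc n) powr - (2 - h))"
  have Z: "(\<lambda>n. real (Suc n) powr - (2 - h)) sums Z"
    unfolding Z_def by (intro summable_sums summable_Suc_powr) (use assms in simp)
  define w where "w k = 1 / (pi\<^sup>2 * (real (Suc k))\<^sup>2)" for k
  have w: "0 \<le> w k" for k by (simp add: w_def)
  have "ennreal r = (\<integral>\<^sup>+x. (\<Sum>k. ennreal (w k) *
      ennreal (indicator {0<..} x * ((1 - cos (2 * pi * real (Suc k) * x)) * x powr (- 1 - h)))) \<partial>lborel)"
    unfolding r(2) [symmetric]
  proof (rule nn_integral_cong)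
    fix x :: real
    have "cos (2 * pi * real (Suc k) * frac x) = cos (2 * pi * real (Suc k) * x)" for k
    proof -
      have "2 * pi * real (Suc k) * frac x = 2 * pi * real (Suc k) * x - 2 * pi * of_int (int (Suc k) * \<lfloor>x\<rfloor>)"
        by (simp add: frac_def algebra_simps)
      then show ?thesis
        by (simp only: cos_diff cos_int_2pin sin_int_2pin)
    qed
    then have "(\<lambda>k. w k * (1 - cos (2 * pi * real (Suc k) * x))) sums (frac x - (frac x)\<^sup>2)"
      using fourier_periodic_parabola[of "frac x"] frac_lt_1[of x] by (simp add: w_def del: of_nat_Suc)
    from sums_mult[OF this, of "indicator {0<..} x * x powr (- 1 - h)"]
    have "(\<lambda>k. w k * (indicator {0<..} x * ((1 - cos (2 * pi * real (Suc k) * x)) * x powr (- 1 - h)))) sums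
      (indicator {0<..} x * ((frac x - (frac x)\<^sup>2) * x powr (- 1 - h)))"
      by (simp add: mult_ac)
    then have "(\<Sum>k. ennreal (w k * (indicator {0<..} x * ((1 - cos (2 * pi * real (Suc k) * x)) * x powr (- 1 - h))))) =
      ennreal (indicator {0<..} x * ((frac x - (frac x)\<^sup>2) * x powr (- 1 - h)))"
      by (intro suminf_ennreal_eq) (auto simp: w)
    then show "ennreal (indicator {0<..} x * ((frac x - (frac x)\<^sup>2) * x powr (- 1 - h))) = (\<Sum>k. ennreal (w k) *
      ennreal (indicator {0<..} x * ((1 - cos (2 * pi * real (Suc k) * x)) * x powr (- 1 - h))))"
      by (simp add: ennreal_mult' w del: of_nat_Suc)
  qed
  also have "\<dots> = (\<Sum>k. \<integral>\<^sup>+x. ennreal (w k) *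
      ennreal (indicator {0<..} x * ((1 - cos (2 * pi * real (Suc k) * x)) * x powr (- 1 - h))) \<partial>lborel)"
    by (rule nn_integral_suminf) measurable
  also have "\<dots> = (\<Sum>k. ennreal ((2 * pi) powr h / pi\<^sup>2 * C * real (Suc k) powr - (2 - h)))"
  proof (rule suminf_cong)
    fix k
    have "(\<integral>\<^sup>+x. ennreal (w k) *
      ennreal (indicator {0<..} x * ((1 - cos (2 * pi * real (Suc k) * x)) * x powr (- 1 - h))) \<partial>lborel)
      = ennreal (w k) * ennreal ((2 * pi * real (Suc k)) powr h * Gamma (h / 2) * Gamma (1 - h / 2) / (2 * Gamma (1 + h)))"
      using nn_integral_one_minus_cos_powr[OF assms, of "2 * pi * real (Suc k)"]
      by (subst nn_integral_cmult) (auto simp del: of_nat_Suc)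
    also have "(2 * pi * real (Suc k)) powr h * Gamma (h / 2) * Gamma (1 - h / 2) / (2 * Gamma (1 + h)) =
      (2 * pi) powr h * real (Suc k) powr h * C"
      by (simp add: C_def powr_mult del: of_nat_Suc)
    also have "ennreal (w k) * ennreal ((2 * pi) powr h * real (Suc k) powr h * C) =
      ennreal (w k * ((2 * pi) powr h * real (Suc k) powr h * C))"
      using w by (simp add: ennreal_mult')
    also have "w k * ((2 * pi) powr h * real (Suc k) powr h * C) = (2 * pi) powr h / pi\<^sup>2 * C * real (Suc k) powr - (2 - h)"
      by (simp add: w_def powr_diff del: of_nat_Suc)
    finally show "(\<integral>\<^sup>+x. ennreal (w k) *
      ennreal (indicator {0<..} x * ((1 - cos (2 * pi * real (Suc k) * x)) * x powr (- 1 - h))) \<partial>lborel)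
      = ennreal ((2 * pi) powr h / pi\<^sup>2 * C * real (Suc k) powr - (2 - h))" .
  qed
  also have "\<dots> = ennreal ((2 * pi) powr h / pi\<^sup>2 * C * Z)"
    by (rule suminf_ennreal_eq[OF _ sums_mult[OF Z]]) (use C in auto)
  finally have "r = (2 * pi) powr h / pi\<^sup>2 * C * Z"
    using r(1) C sums_le[OF _ sums_zero Z] by (subst (asm) ennreal_inj) auto
  moreover have "Gamma (1 + h) \<noteq> 0"
    by (rule less_imp_neq[OF Gamma_real_pos, symmetric]) (use assms in simp)
  ultimately have r': "r * Gamma (1 + h) = (2 * pi) powr h / pi\<^sup>2 * (Gamma (h / 2) * Gamma (1 - h / 2) / 2) * Z"
    by (simp add: C_def)
  have "h / 2 \<notin> \<int>\<^sub>\<le>\<^sub>0" using assms by (auto dest: nonpos_Ints_nonpos)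
  then have g: "Gamma (1 + h / 2) = h / 2 * Gamma (h / 2)"
    using Gamma_plus1[of "h / 2"] by (simp add: add.commute)
  have "(h - 1) * h / 2 * r * Gamma (1 + h) = (h - 1) * h / 2 * (r * Gamma (1 + h))" by simp
  also have "\<dots> = (h - 1) / (2 * pi\<^sup>2) * (2 * pi) powr h * Gamma (1 + h / 2) * Gamma (1 - h / 2) * Z"
    unfolding r' g by simp
  finally have "(h - 1) * h / 2 * r * Gamma (1 + h) =
    (h - 1) / (2 * pi\<^sup>2) * (2 * pi) powr h * Gamma (1 + h / 2) * Gamma (1 - h / 2) * Z" .
  moreover have "zeta (of_real (2 - h)) = of_real Z"
    unfolding Z_def using assms by (intro zeta_of_real_sums) simp
  ultimately show ?thesis unfolding r(3) by (simp only: of_real_mult [symmetric])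
qed

lemma deriv_eq_if_eq_on_right:
  fixes f g :: "complex \<Rightarrow> complex"
  assumes f: "(f has_field_derivative f') (at 0)" and g: "(g has_field_derivative g') (at 0)"
    and eq: "\<And>h::real. 0 < h \<Longrightarrow> h < 1 \<Longrightarrow> f (of_real h) = g (of_real h)"
  shows "f 0 = g 0" "f' = g'"
proof -
  have ev: "\<forall>\<^sub>F h in at_right 0. f (of_real h) = g (of_real h)"
    using eventually_at_right_real[OF zero_less_one] by eventually_elim (auto intro: eq)
  have lim: "filterlim of_real (at (0::complex)) (at_right (0::real))"
    unfolding filterlim_at by (auto intro!: tendsto_eq_intros simp: eventually_at_right_less eventually_at_filter)
  have "((\<lambda>h. f (of_real h) - g (of_real h)) \<longlongrightarrow> f 0 - g 0) (at_right (0::real))"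
    using DERIV_isCont[OF f] DERIV_isCont[OF g]
    by (intro tendsto_diff filterlim_compose[OF _ lim]) (simp_all add: isCont_def)
  moreover have "\<forall>\<^sub>F h in at_right (0::real). f (of_real h) - g (of_real h) = 0"
    using ev by eventually_elim simp
  ultimately have "f 0 - g 0 = 0"
    by (intro tendsto_unique[OF trivial_limit_at_right_real _ tendsto_eventually])
  then show 0: "f 0 = g 0" by simp
  have "((\<lambda>h. (f (of_real h) - f 0) / of_real h - (g (of_real h) - g 0) / of_real h) \<longlongrightarrow> f' - g') (at_right (0::real))"
    using f g unfolding has_field_derivative_iff
    by (intro tendsto_diff) (auto dest: filterlim_compose[OF _ lim])
  moreover have "\<forall>\<^sub>F h in at_right (0::real). (f (of_real h) - f 0) / of_real h - (g (of_real h) - g 0) / of_real h = 0"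
    using ev by eventually_elim (simp add: 0)
  ultimately have "f' - g' = 0"
    by (intro tendsto_unique[OF trivial_limit_at_right_real _ tendsto_eventually])
  then show "f' = g'" by simp
qed

lemma zeta_has_deriv: "s \<noteq> 1 \<Longrightarrow> (zeta has_field_derivative deriv zeta s) (at s)"
  using is_zeta_continuation_zeta
  by (intro holomorphic_derivI[where S = "- {1}"]) (auto simp: is_zeta_continuation_def)

lemma zeta_2: "zeta 2 = of_real (pi\<^sup>2 / 6)"
proof -
  have "(\<lambda>n. real (Suc n) powr - 2) sums (pi\<^sup>2 / 6)"
    using inverse_squares_sums by (simp add: powr_minus_divide add.commute)
  then have "(\<Sum>n. real (Suc n) powr - 2) = pi\<^sup>2 / 6" by (rule sums_unique[symmetric])
  moreover have "zeta (of_real 2) = of_real (\<Sum>n. real (Suc n) powr - 2)" by (rule zeta_of_real_sums) simp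
  ultimately have "zeta (of_real 2) = of_real (pi\<^sup>2 / 6)" by (simp only:)
  then show ?thesis by simp
qed

lemma deriv_zeta_2_eq:
  "deriv zeta 2 = of_real (pi\<^sup>2 / 6 * (ln (2 * pi) + euler_mascheroni - 1)) + 2 * of_real pi ^ 2 * deriv zeta (- 1)"
proof -
  define A where "A z = zeta (z - 1) * Gamma (1 + z)" for z
  define B where "B z = (z - 1) / (2 * of_real pi ^ 2) * exp (of_real (ln (2 * pi)) * z) * Gamma (1 + z / 2) * Gamma (1 - z / 2) * zeta (2 - z)" for z
  have dz: "((\<lambda>z. zeta (z - 1)) has_field_derivative deriv zeta (- 1)) (at 0)"
    "((\<lambda>z. zeta (2 - z)) has_field_derivative - deriv zeta 2) (at 0)"
  proof -
    have "((\<lambda>z. z - 1) has_field_derivative 1) (at (0 :: complex))"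
      "((\<lambda>z. 2 - z) has_field_derivative - 1) (at (0 :: complex))"
      by (auto intro!: derivative_eq_intros)
    then show "((\<lambda>z. zeta (z - 1)) has_field_derivative deriv zeta (- 1)) (at 0)"
      "((\<lambda>z. zeta (2 - z)) has_field_derivative - deriv zeta 2) (at 0)"
      using DERIV_chain2[of zeta "deriv zeta (- 1)" "\<lambda>z. z - 1" 0 1 UNIV] zeta_has_deriv[of "- 1"]
        DERIV_chain2[of zeta "deriv zeta 2" "\<lambda>z. 2 - z" 0 "- 1" UNIV] zeta_has_deriv[of 2]
      by simp_all
  qed
  have A: "(A has_field_derivative deriv zeta (- 1) - zeta (- 1) * euler_mascheroni) (at 0)"
    unfolding A_def [abs_def] by (auto intro!: derivative_eq_intros dz)
  have B: "(B has_field_derivative (zeta 2 - ln (2 * pi) * zeta 2 + deriv zeta 2) / (2 * of_real pi ^ 2)) (at 0)"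
    unfolding B_def [abs_def]
    by (auto intro!: derivative_eq_intros dz) (simp add: field_simps)
  have eq: "A (of_real h) = B (of_real h)" if "0 < h" "h < 1" for h :: real
  proof -
    have "exp (of_real (ln (2 * pi)) * complex_of_real h) = of_real ((2 * pi) powr h)"
      by (simp add: powr_def mult.commute flip: exp_of_real of_real_mult)
    moreover have "Gamma (1 + complex_of_real h) = of_real (Gamma (1 + h))"
      "Gamma (1 + complex_of_real h / 2) = of_real (Gamma (1 + h / 2))"
      "Gamma (1 - complex_of_real h / 2) = of_real (Gamma (1 - h / 2))"
      by (simp_all flip: Gamma_complex_of_real)
    ultimately show ?thesis
      using zeta_functional_equation_strip[OF that] unfolding A_def B_def by simp
  qed
  have 0: "zeta (- 1) = - zeta 2 / (2 * of_real pi ^ 2)"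
    using deriv_eq_if_eq_on_right(1)[OF A B eq] by (simp add: A_def B_def)
  have 1: "deriv zeta (- 1) - zeta (- 1) * euler_mascheroni = (zeta 2 - ln (2 * pi) * zeta 2 + deriv zeta 2) / (2 * of_real pi ^ 2)"
    by (rule deriv_eq_if_eq_on_right(2)[OF A B eq])
  have "deriv zeta 2 = 2 * of_real pi ^ 2 * deriv zeta (- 1) + zeta 2 * (ln (2 * pi) + euler_mascheroni - 1)"
    using 1 unfolding 0 by (simp add: field_simps)
  then show ?thesis unfolding zeta_2 by (simp add: algebra_simps)
qed

lemma deriv_zeta_2_sums: "(\<lambda>n. ln (real (Suc n)) / (real (Suc n))\<^sup>2) sums (- Re (deriv zeta 2))"
  "deriv zeta 2 \<in> \<real>"
proof -
  define S where "S = {s. 3 / 2 < Re s}"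
  define f where "f n s = exp (- s * of_real (ln (real (Suc n))))" for n and s :: complex
  have f: "f n s = of_nat (Suc n) powr (- s)" for n s
    using zexp_endpoints(1)[of n s] by (simp add: zexp_def f_def add.commute)
  have S: "open S" unfolding S_def by (rule open_halfspace_Re_gt)
  have df: "(f n has_field_derivative - of_real (ln (real (Suc n))) * f n s) (at s)" for n s
    unfolding f_def [abs_def] by (auto intro!: derivative_eq_intros)
  have "norm (f n s) \<le> real (Suc n) powr - (3 / 2)" if "s \<in> S" for n s
    unfolding f norm_Suc_powr using that by (intro powr_mono) (auto simp: S_def)
  then have "\<forall>\<^sub>F n in sequentially. \<forall>s\<in>S. norm (f n s) \<le> real (Suc n) powr - (3 / 2)"
    by (intro always_eventually allI ballI)
  moreover have "summable (\<lambda>n. real (Suc n) powr - (3 / 2))"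
    by (rule summable_Suc_powr) simp
  ultimately obtain g g' where g: "\<forall>s\<in>S. (\<lambda>n. f n s) sums g s \<and>
     (\<lambda>n. - of_real (ln (real (Suc n))) * f n s) sums g' s \<and> (g has_field_derivative g' s) (at s)"
    by (elim series_and_derivative_comparison[OF S _ df, rotated])
  have 2: "2 \<in> S" by (simp add: S_def)
  have "g s = zeta s" if "s \<in> S" for s
  proof -
    have "1 < Re s" using that by (simp add: S_def)
    then have "(\<lambda>n. f n s) sums zeta s"
      using is_zeta_continuation_zeta unfolding f by (simp add: is_zeta_continuation_def)
    moreover have "(\<lambda>n. f n s) sums g s" using g that by blast
    ultimately show ?thesis by (rule sums_unique2[rotated])
  qed
  moreover have "(g has_field_derivative g' 2) (at 2)" using g 2 by blast
  ultimately have "(zeta has_field_derivative g' 2) (at 2)"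
    by (rule has_field_derivative_transform_within_open[OF _ S 2, rotated])
  then have "g' 2 = deriv zeta 2" by (rule DERIV_imp_deriv[symmetric])
  moreover have "(\<lambda>n. - of_real (ln (real (Suc n))) * f n 2) sums g' 2" using g 2 by blast
  ultimately have "(\<lambda>n. - of_real (ln (real (Suc n))) * f n 2) sums deriv zeta 2"
    by (simp only:)
  moreover have "f n 2 = of_real (1 / (real (Suc n))\<^sup>2)" for n
  proof -
    have "f n 2 = of_real (exp (- (2 * ln (real (Suc n)))))" by (simp add: f_def flip: exp_of_real)
    also have "exp (- (2 * ln (real (Suc n)))) = 1 / (real (Suc n))\<^sup>2"
      by (simp add: exp_minus exp_double divide_inverse del: of_nat_Suc)
    finally show ?thesis .
  qed
  ultimately have *: "(\<lambda>n. complex_of_real (- (ln (real (Suc n)) / (real (Suc n))\<^sup>2))) sums deriv zeta 2"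
    by (simp del: of_nat_Suc)
  from sums_Re[OF this] have "(\<lambda>n. - (ln (real (Suc n)) / (real (Suc n))\<^sup>2)) sums Re (deriv zeta 2)"
    by (simp del: of_nat_Suc)
  from sums_minus[OF this] show "(\<lambda>n. ln (real (Suc n)) / (real (Suc n))\<^sup>2) sums (- Re (deriv zeta 2))"
    by (simp del: of_nat_Suc)
  from sums_Im[OF *] have "Im (deriv zeta 2) = 0" by (simp add: sums_iff del: of_nat_Suc)
  then show "deriv zeta 2 \<in> \<real>" by (simp add: complex_is_Real_iff)
qed

lemma sums_multiples:
  fixes f :: "nat \<Rightarrow> 'a :: real_normed_vector"
  assumes "0 < m" "(\<lambda>j. f (m * Suc j)) sums c"
  shows "(\<lambda>k. if m dvd Suc k then f (Suc k) else 0) sums c"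
proof -
  define r where "r j = m * Suc j - 1" for j
  have r: "Suc (r j) = m * Suc j" for j using assms(1) by (simp add: r_def)
  have "strict_mono r"
  proof (rule strict_monoI_Suc)
    fix j
    have "Suc (r j) < Suc (r (Suc j))" unfolding r using assms(1) by simp
    then show "r j < r (Suc j)" by simp
  qed
  moreover have "(if m dvd Suc n then f (Suc n) else 0) = 0" if "n \<notin> range r" for n
  proof (cases "m dvd Suc n")
    case True
    then obtain j where j: "Suc n = m * j" by blast
    then obtain i where "j = Suc i" by (cases j) auto
    with j have "n = r i" using r[of i] by simp
    with that show ?thesis by blast
  qed auto
  ultimately show ?thesis
    using assms(2) by (subst sums_mono_reindex[of r, symmetric]) (auto simp: r)
qed

lemma cos_half_pi_multiple:
  "cos (real n * pi / 2) = 2 * of_bool (4 dvd n) - of_bool (2 dvd n)"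
proof -
  define m i where "m = n div 4" and "i = n mod 4"
  have n: "n = i + 4 * m" by (simp add: m_def i_def)
  have "real n * pi / 2 = real i * pi / 2 + 2 * pi * real m" unfolding n by (simp add: algebra_simps)
  then have c: "cos (real n * pi / 2) = cos (real i * pi / 2)"
    by (simp only: cos_add cos_int_2pin[of "int m", simplified] sin_int_2pin[of "int m", simplified])
  have "i < 4" by (simp add: i_def)
  then consider "i = 0" | "i = 1" | "i = 2" | "i = 3" by linarith
  then have "cos (real i * pi / 2) = 2 * of_bool (i = 0) - of_bool (even i)"
  proof cases
    case 4
    have "3 * pi / 2 = pi + pi / 2" by simp
    then have "cos (3 * pi / 2) = 0" by (simp only: cos_add) simp
    then show ?thesis using 4 by simp
  qed simp_all
  moreover have "4 dvd n \<longleftrightarrow> i = 0" "2 dvd n \<longleftrightarrow> even i" unfolding i_def by presburger+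
  ultimately show ?thesis unfolding c by simp
qed

theorem mainTheorem7:
  shows "(\<lambda>k. complex_of_real
            (ln (real (Suc k)) * cos (real (Suc k) * pi / 2) / (pi * real (Suc k)) ^ 2))
         sums (complex_of_real (1 / 48 * (ln (2 * pi) + euler_mascheroni - 1))
               + 1 / 4 * deriv zeta (- 1))"
proof -
  define L where "L = - Re (deriv zeta 2)"
  have L: "(\<lambda>n. ln (real (Suc n)) / (real (Suc n))\<^sup>2) sums L"
    unfolding L_def by (rule deriv_zeta_2_sums)
  have sq: "(\<lambda>n. 1 / (real (Suc n))\<^sup>2) sums (pi\<^sup>2 / 6)"
    using inverse_squares_sums by (simp add: add.commute)
  define f where "f n = ln (real n) / (real n)\<^sup>2" for n
  have m: "(\<lambda>k. if m dvd Suc k then f (Suc k) else 0) sums (ln (real m) / (real m)\<^sup>2 * (pi\<^sup>2 / 6) + L / (real m)\<^sup>2)"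
    if "0 < m" for m
  proof (rule sums_multiples[OF that])
    have "f (m * Suc j) = ln (real m) / (real m)\<^sup>2 * (1 / (real (Suc j))\<^sup>2) + ln (real (Suc j)) / (real (Suc j))\<^sup>2 / (real m)\<^sup>2" for j
      using that by (simp add: f_def ln_mult power_mult_distrib add_divide_distrib mult.commute del: of_nat_Suc mult_Suc_right)
    then show "(\<lambda>j. f (m * Suc j)) sums (ln (real m) / (real m)\<^sup>2 * (pi\<^sup>2 / 6) + L / (real m)\<^sup>2)"
      by (simp only:) (intro sums_add sums_mult sums_divide L sq)
  qed
  have "ln (4::real) = 2 * ln 2" using ln_realpow[of 2 2] by simp
  then have "2 * (ln (real 4) / (real 4)\<^sup>2 * (pi\<^sup>2 / 6) + L / (real 4)\<^sup>2) - (ln (real 2) / (real 2)\<^sup>2 * (pi\<^sup>2 / 6) + L / (real 2)\<^sup>2) = - L / 8"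
    by simp
  then have "(\<lambda>k. 2 * (if 4 dvd Suc k then f (Suc k) else 0) - (if 2 dvd Suc k then f (Suc k) else 0)) sums (- L / 8)"
    using sums_diff[OF sums_mult[OF m[of 4], of 2] m[of 2]] by simp
  from sums_divide[OF this, of "pi\<^sup>2"]
  have "(\<lambda>k. ln (real (Suc k)) * cos (real (Suc k) * pi / 2) / (pi * real (Suc k)) ^ 2) sums (- L / 8 / pi\<^sup>2)"
    by (rule back_subst[of "\<lambda>F. F sums _"])
       (auto simp: fun_eq_iff cos_half_pi_multiple f_def power_mult_distrib simp del: of_nat_Suc)
  then have "(\<lambda>k. complex_of_real (ln (real (Suc k)) * cos (real (Suc k) * pi / 2) / (pi * real (Suc k)) ^ 2))
      sums complex_of_real (- L / 8 / pi\<^sup>2)"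
    unfolding sums_of_real_iff .
  also have "complex_of_real (- L / 8 / pi\<^sup>2) = deriv zeta 2 / (8 * of_real pi ^ 2)"
    using deriv_zeta_2_sums(2) by (simp add: L_def of_real_Re)
  also have "\<dots> = complex_of_real (1 / 48 * (ln (2 * pi) + euler_mascheroni - 1)) + 1 / 4 * deriv zeta (- 1)"
    unfolding deriv_zeta_2_eq by (simp add: field_simps)
  finally show ?thesis .
qed

end
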